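(* Let $d$ and $n$ be positive integers and let $\Gamma$ be a weighted graph with $l$ edges, input vertex $\{0\}$ and output vertices $\{1,\dots,n\}$. If $\Gamma(0,1)=1$, then there exists a unitary operator $\mathbf z_\Gamma$ acting on the output digits, i.e. on $l_2(\mathbb{Z}_d^{\{1,\dots,n\}})$, such that $$\mathbf v_\Gamma=\mathbf z_\Gamma\,\mathbf w_{\{2,\dots,n\}} .$$ Furthermore, $\mathbf z_\Gamma$ can be decomposed into a product of $l+n-1$ elementary gate operations on the output digits, each of which is either a controlled shift gate $\mathbf c(i,j)^m$ ($i\neq j$ in $\{1,\dots,n\}$, $m\in\mathbb{Z}$) or a local Fourier transform $F_i$ ($i\in\{1,\dots,n\}$).
   Context: Write $\mathbb{Z}_d$ for the cyclic group (ring) of integers mod $d$. For $g,h\in\mathbb{Z}_d$ put $\chi(g|h)=\exp\left(\frac{2\pi i}{d}gh\right)$. A weighted graph $\Gamma$ on a finite vertex set $V$ is a symmetric matrix $(\Gamma(i,j)\mid i,j\in V)$ of integers, with no self-links; $\Gamma(i,j)$ is the weight of the edge $\{i,j\}$ ($i\ne j$), and $\Gamma(i,j)=0$ means there is no edge between $i$ and $j$. The number of edges is the number of two-element subsets $\{i,j\}\subset V$ with $\Gamma(i,j)\neq0$. Here $V=\{0,1,\dots,n\}$, with set of input vertices $X=\{0\}$ and set of output vertices $Y=\{1,\dots,n\}$. For a finite set $K$, $l_2(\mathbb{Z}_d^K)$ is the Hilbert space of complex functions on $\mathbb{Z}_d^K$ with orthonormal basis $|\mathbf g\rangle$, $\mathbf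 g\in\mathbb{Z}_d^K$. Cluster state wave function: $\Psi_\Gamma(\mathbf g)=d^{-\frac12|V|}\prod_{\{i,j\}\subset V}\chi(g_i|g_j)^{\Gamma(i,j)}$ for $\mathbf g\in\mathbb{Z}_d^V$ (product over all two-element subsets of $V$). Graph code: $\mathbf v_\Gamma:l_2(\mathbb{Z}_d^X)\to l_2(\mathbb{Z}_d^Y)$ is the linear map with $\mathbf v_\Gamma|h\rangle=d^{\frac12|X|}\sum_{\mathbf g\in\mathbb{Z}_d^Y}\Psi_\Gamma(h,\mathbf g)|\mathbf g\rangle$ for $h\in\mathbb{Z}_d^X=\mathbb{Z}_d$. $\mathbf w_{\{2,\dots,n\}}: l_2(\mathbb{Z}_d)\to l_2(\mathbb{Z}_d^{\{1,\dots,n\}})$ is the isometry $|h\rangle\mapsto|h,\mathbf 0_{\{2,\dots,n\}}\rangle$, putting $h$ at output position $1$ and $0$ at positions $2,\dots,n$; here the input space $l_2(\mathbb{Z}_d^{\{0\}})=l_2(\mathbb{Z}_d)$ is identified with $l_2(\mathbb{Z}_d^{\{1\}})$. Gates on $l_2(\mathbb{Z}_d^Y)$: the local Fourier transform at $i$ is the unitary $F_i|\mathbf g\rangle=\frac1{\sqrt d}\sum_{h\in\mathbb{Z}_d}\chi(g_i|h)|h,\mathbf g^i\rangle$ (the $i$-th entry $g_i$ replaced by $h$). The $m$-controlled shift gate with control $i$ and target $j\neq i$ ($m\in\mathbb{Z}$) is the unitary $\mathbf c(i,j)^m$ replacing the $j$-th entry $g_j$ of $|\mathbf g\rangle$ by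 $g_j+mg_i$; for every integer $m$ it counts as a single controlled shift gate. *)

theory Defs
  imports Complex_Main "HOL-Library.FuncSet"
begin

(* The ring of integers mod d is represented by the residues 0, ..., d - 1. *)
definition Zmod :: "nat \<Rightarrow> int set" where
  "Zmod d = {0..<int d}"

type_synonym config = "nat \<Rightarrow> int"
type_synonym state = "config \<Rightarrow> complex"

(* The labels of the standard basis: families of residues indexed by K
   (extensional, i.e. undefined outside K). *)
definition configs :: "nat \<Rightarrow> nat set \<Rightarrow> config set" where
  "configs d K = K \<rightarrow>\<^sub>E Zmod d"

(* Complex functions on configs d K, represented by their extension by 0. *)
definition l2 :: "nat \<Rightarrow> nat set \<Rightarrow> state set" where
  "l2 d K = {\<psi>. \<forall>g. g \<notin> configs d K \<longrightarrow> \<psi> g = 0}"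

definition ket :: "config \<Rightarrow> state" where
  "ket g = (\<lambda>x. if x = g then 1 else 0)"

definition l2_inner :: "nat \<Rightarrow> nat set \<Rightarrow> state \<Rightarrow> state \<Rightarrow> complex" where
  "l2_inner d K \<phi> \<psi> = (\<Sum>g\<in>configs d K. cnj (\<phi> g) * \<psi> g)"

definition linear_l2 :: "nat \<Rightarrow> nat set \<Rightarrow> nat set \<Rightarrow> (state \<Rightarrow> state) \<Rightarrow> bool" where
  "linear_l2 d K L T \<longleftrightarrow>
     T \<in> l2 d K \<rightarrow> l2 d L \<and>
     (\<forall>\<phi>\<in>l2 d K. \<forall>\<psi>\<in>l2 d K. T (\<lambda>g. \<phi> g + \<psi> g) = (\<lambda>x. T \<phi> x + T \<psi> x)) \<and>
     (\<forall>c. \<forall>\<psi>\<in>l2 d K. T (\<lambda>g. c * \<psi> g) = (\<lambda>x. c * T \<psi> x))"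

definition unitary_l2 :: "nat \<Rightarrow> nat set \<Rightarrow> (state \<Rightarrow> state) \<Rightarrow> bool" where
  "unitary_l2 d K T \<longleftrightarrow>
     linear_l2 d K K T \<and>
     bij_betw T (l2 d K) (l2 d K) \<and>
     (\<forall>\<phi>\<in>l2 d K. \<forall>\<psi>\<in>l2 d K. l2_inner d K (T \<phi>) (T \<psi>) = l2_inner d K \<phi> \<psi>)"

(* The linear map sending each basis vector ket g, g in configs d K, to B g;
   see lin_ext_ket and linear_l2_lin_ext below. *)
definition lin_ext :: "nat \<Rightarrow> nat set \<Rightarrow> (config \<Rightarrow> state) \<Rightarrow> state \<Rightarrow> state" where
  "lin_ext d K B \<psi> = (\<lambda>x. \<Sum>g\<in>configs d K. \<psi> g * B g x)"

lemma finite_configs: "finite K \<Longrightarrow> finite (configs d K)"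
  by (simp add: configs_def Zmod_def finite_PiE)

lemma lin_ext_ket:
  assumes "finite K" "g \<in> configs d K"
  shows "lin_ext d K B (ket g) = B g"
proof
  fix x
  have "lin_ext d K B (ket g) x = (\<Sum>g'\<in>configs d K. if g' = g then B g' x else 0)"
    unfolding lin_ext_def ket_def by (intro sum.cong) auto
  also have "\<dots> = B g x"
    using assms finite_configs[of K d] by simp
  finally show "lin_ext d K B (ket g) x = B g x" .
qed

lemma linear_l2_lin_ext:
  assumes "\<And>g. g \<in> configs d K \<Longrightarrow> B g \<in> l2 d L"
  shows "linear_l2 d K L (lin_ext d K B)"
  using assms
  by (auto simp: linear_l2_def lin_ext_def l2_def fun_eq_iff sum.distrib sum_distrib_left
      algebra_simps)

definition \<chi> :: "nat \<Rightarrow> int \<Rightarrow> int \<Rightarrow> complex" where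
  "\<chi> d g h = exp (2 * of_real pi * \<i> / of_nat d * (of_int g * of_int h))"

definition weighted_graph :: "nat set \<Rightarrow> (nat \<Rightarrow> nat \<Rightarrow> int) \<Rightarrow> bool" where
  "weighted_graph V \<Gamma> \<longleftrightarrow>
     finite V \<and> (\<forall>i\<in>V. \<forall>j\<in>V. \<Gamma> i j = \<Gamma> j i) \<and> (\<forall>i\<in>V. \<Gamma> i i = 0)"

definition edges :: "nat set \<Rightarrow> (nat \<Rightarrow> nat \<Rightarrow> int) \<Rightarrow> nat set set" where
  "edges V \<Gamma> = {{i, j} | i j. i \<in> V \<and> j \<in> V \<and> i \<noteq> j \<and> \<Gamma> i j \<noteq> 0}"

(* The two-element subsets of V are enumerated as the pairs i < j; the order
   within a pair is irrelevant since \<Gamma> and \<chi> d are symmetric. *)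
definition cluster_wave :: "nat \<Rightarrow> nat set \<Rightarrow> (nat \<Rightarrow> nat \<Rightarrow> int) \<Rightarrow> config \<Rightarrow> complex" where
  "cluster_wave d V \<Gamma> g =
     of_real (real d powr (- (real (card V) / 2))) *
     (\<Prod>(i, j)\<in>{(i, j). i \<in> V \<and> j \<in> V \<and> i < j}. \<chi> d (g i) (g j) powi \<Gamma> i j)"

definition join :: "nat set \<Rightarrow> config \<Rightarrow> config \<Rightarrow> config" where
  "join X h g = (\<lambda>i. if i \<in> X then h i else g i)"

definition graph_code ::
    "nat \<Rightarrow> nat set \<Rightarrow> nat set \<Rightarrow> (nat \<Rightarrow> nat \<Rightarrow> int) \<Rightarrow> state \<Rightarrow> state" where
  "graph_code d X Y \<Gamma> =
     lin_ext d X (\<lambda>h x. of_real (real d powr (real (card X) / 2)) *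
       (\<Sum>g\<in>configs d Y. cluster_wave d (X \<union> Y) \<Gamma> (join X h g) * ket g x))"

(* The isometry w with index set {2..n}; the input digit sits at position 0 and
   is moved to position 1. *)
definition embed_first :: "nat \<Rightarrow> nat \<Rightarrow> state \<Rightarrow> state" where
  "embed_first d n =
     lin_ext d {0} (\<lambda>h. ket (\<lambda>i\<in>{1..n}. if i = 1 then h 0 else 0))"

definition fourier_gate :: "nat \<Rightarrow> nat set \<Rightarrow> nat \<Rightarrow> state \<Rightarrow> state" where
  "fourier_gate d Y i =
     lin_ext d Y (\<lambda>g x. of_real (1 / sqrt (real d)) *
       (\<Sum>h\<in>Zmod d. \<chi> d (g i) h * ket (g(i := h)) x))"

definition cshift_gate :: "nat \<Rightarrow> nat set \<Rightarrow> nat \<Rightarrow> nat \<Rightarrow> int \<Rightarrow> state \<Rightarrow> state" where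
  "cshift_gate d Y i j m =
     lin_ext d Y (\<lambda>g. ket (g(j := (g j + m * g i) mod int d)))"

definition elementary_gates :: "nat \<Rightarrow> nat set \<Rightarrow> (state \<Rightarrow> state) set" where
  "elementary_gates d Y =
     {cshift_gate d Y i j m | i j m. i \<in> Y \<and> j \<in> Y \<and> i \<noteq> j} \<union>
     {fourier_gate d Y i | i. i \<in> Y}"

end

theory Submission
  imports Defs
begin

text \<open>
  Put \<open>g\<^sub>0 = h\<close>. The code word is built up one output digit at a time. After stage \<open>k\<close> the state is
  \<open>d\<^bsup>-k/2\<^esup> \<Sum> \<Prod>\<^bsub>i<j\<le>k\<^esub> \<chi>(g\<^sub>i|g\<^sub>j)\<^bsup>\<Gamma>(i,j)\<^esup> |g\<^sub>1,\<dots>,g\<^sub>k,a\<^sub>k\<^sub>+\<^sub>1,\<dots>,a\<^sub>n\<rangle>\<close>, where digit \<open>j > k\<close> holds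
  the number \<open>a\<^sub>j = \<Sum>\<^bsub>i\<le>k\<^esub> \<Gamma>(i,j) g\<^sub>i\<close>. A Fourier transform at \<open>k+1\<close> turns the stored
  \<open>a\<^sub>k\<^sub>+\<^sub>1\<close> into the phase \<open>\<chi>(a\<^sub>k\<^sub>+\<^sub>1|g\<^sub>k\<^sub>+\<^sub>1)\<close>, which is the contribution of all edges from
  \<open>k+1\<close> to smaller vertices; then one controlled shift for each edge from \<open>k+1\<close> to a larger
  vertex updates the remaining \<open>a\<^sub>j\<close>. Stage 0 starts from \<open>|h,0,\<dots>,0\<rangle>\<close>; since \<open>\<Gamma>(0,1) = 1\<close>,
  \<open>a\<^sub>1 = h\<close> is already in place and the edge \<open>{0,1}\<close> costs no gate.
\<close>

section \<open>Characters\<close>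

lemma \<chi>_commute: "\<chi> d a b = \<chi> d b a"
  by (simp add: \<chi>_def mult.commute)

lemma \<chi>_0: "\<chi> d 0 b = 1"
  by (simp add: \<chi>_def)

lemma \<chi>_add: "\<chi> d (a + b) c = \<chi> d a c * \<chi> d b c"
  by (simp add: \<chi>_def exp_add[symmetric] add_divide_distrib algebra_simps)

lemma \<chi>_mult: "\<chi> d (m * a) c = \<chi> d a c powi m"
  by (simp add: \<chi>_def exp_power_int algebra_simps)

text \<open>This converts a stored linear combination of digits into a product of edge
  phases.\<close>

lemma \<chi>_sum: "\<chi> d (\<Sum>i\<in>A. m i * a i) c = (\<Prod>i\<in>A. \<chi> d (a i) c powi m i)"
  by (induction A rule: infinite_finite_induct) (auto simp: \<chi>_0 \<chi>_add \<chi>_mult)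

lemma \<chi>_cis: "\<chi> d a c = cis (2 * pi * (of_int (a * c) / of_nat d))"
  by (simp add: \<chi>_def cis_conv_exp mult_ac)

lemma cnj_\<chi>: "cnj (\<chi> d a c) = \<chi> d (- a) c"
  by (simp add: \<chi>_cis cis_cnj)

text \<open>The value is \<open>cis\<close> of the angle 2 pi a / d, and its cosine is 1 only at
  integer multiples of 2 pi.\<close>

lemma \<chi>_eq_1_iff:
  assumes "d > 0"
  shows "\<chi> d a 1 = 1 \<longleftrightarrow> int d dvd a"
proof -
  have "\<chi> d a 1 = 1 \<longleftrightarrow> (\<exists>k::int. of_int a / of_nat d = (of_int k :: real))"
  proof
    assume "\<chi> d a 1 = 1"
    then have "cos (2 * pi * (of_int a / of_nat d)) = 1"
      by (simp add: \<chi>_cis complex_eq_iff)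
    then obtain k :: int where "2 * pi * (of_int a / of_nat d) = of_int k * 2 * pi"
      by (auto simp: cos_one_2pi_int)
    then have "2 * pi * (of_int a / of_nat d) = 2 * pi * (of_int k :: real)" by (simp only: mult_ac)
    then have "of_int a / of_nat d = (of_int k :: real)" unfolding mult_cancel_left by simp
    then show "\<exists>k::int. of_int a / of_nat d = (of_int k :: real)" ..
  next
    assume "\<exists>k::int. of_int a / of_nat d = (of_int k :: real)"
    then obtain k :: int where k: "of_int a / of_nat d = (of_int k :: real)" ..
    show "\<chi> d a 1 = 1"
      unfolding \<chi>_cis mult_1_right k by (simp add: cis_multiple_2pi)
  qed
  also have "\<dots> \<longleftrightarrow> (\<exists>k. a = int d * k)"
  proof (intro ex_cong1)
    fix k
    have "of_int a / of_nat d = (of_int k :: real) \<longleftrightarrow> real_of_int a = real_of_int (int d * k)"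
      using assms by (simp add: field_simps)
    then show "(of_int a / of_nat d = (of_int k :: real)) = (a = int d * k)"
      by (simp only: of_int_eq_iff)
  qed
  finally show ?thesis by (simp add: dvd_def)
qed

text \<open>Multiples of \<open>d\<close> contribute the phase 1, so characters descend to residues;
  this lets phases ignore the reductions mod \<open>d\<close> made by the gates.\<close>

lemma \<chi>_mod:
  assumes "d > 0"
  shows "\<chi> d (a mod int d) c = \<chi> d a c"
proof -
  have "\<chi> d (int d * k) c = 1" for k
  proof -
    have "\<chi> d (int d * k) c = \<chi> d (int d * k * c) 1"
      by (simp add: \<chi>_def mult_ac)
    then show ?thesis using \<chi>_eq_1_iff[OF assms, of "int d * k * c"] by simp
  qed
  then have "\<chi> d (int d * (a div int d) + a mod int d) c = \<chi> d (a mod int d) c"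
    by (simp only: \<chi>_add) simp
  then show ?thesis by simp
qed

text \<open>Orthogonality of characters, as a geometric sum in \<open>q = \<chi> d a 1\<close>:
  every term is 1 if \<open>q = 1\<close>, and otherwise \<open>q ^ d = 1\<close> makes the sum
  vanish.\<close>

lemma sum_Zmod_\<chi>:
  assumes "d > 0"
  shows "(\<Sum>c\<in>Zmod d. \<chi> d a c) = (if int d dvd a then of_nat d else 0)"
proof -
  have pow: "\<chi> d a (int k) = \<chi> d a 1 ^ k" for k
    by (metis \<chi>_commute \<chi>_mult mult.right_neutral power_int_of_nat)
  have "Zmod d = int ` {..<d}"
    using image_int_atLeastLessThan[of 0 d] by (simp add: Zmod_def atLeast0LessThan)
  then have sum: "(\<Sum>c\<in>Zmod d. \<chi> d a c) = (\<Sum>k<d. \<chi> d a 1 ^ k)"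
    by (simp add: sum.reindex pow)
  show ?thesis
  proof (cases "int d dvd a")
    case True
    then have "\<chi> d a 1 = 1" using \<chi>_eq_1_iff[OF assms] by simp
    then show ?thesis using True by (simp add: sum)
  next
    case False
    then have "\<chi> d a 1 \<noteq> 1" using \<chi>_eq_1_iff[OF assms] by simp
    moreover have "\<chi> d a 1 ^ d = 1"
    proof -
      have "\<chi> d a 1 ^ d = \<chi> d (int d * a) 1"
        by (simp add: \<chi>_mult)
      then show ?thesis using \<chi>_eq_1_iff[OF assms, of "int d * a"] by simp
    qed
    then have "(1 - \<chi> d a 1) * (\<Sum>k<d. \<chi> d a 1 ^ k) = 0"
      by (simp add: one_diff_power_eq[symmetric])
    ultimately show ?thesis using False by (simp add: sum)
  qed
qed

lemma Zmod_dvd_diff_iff: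
  assumes "a \<in> Zmod d" "b \<in> Zmod d"
  shows "int d dvd a - b \<longleftrightarrow> a = b"
  using assms by (auto simp: Zmod_def mod_eq_dvd_iff[symmetric])

lemma mod_in_Zmod: "d > 0 \<Longrightarrow> a mod int d \<in> Zmod d"
  by (simp add: Zmod_def)

section \<open>Linear and unitary maps\<close>

lemma configs_upd: "g \<in> configs d K \<Longrightarrow> i \<in> K \<Longrightarrow> a \<in> Zmod d \<Longrightarrow> g(i := a) \<in> configs d K"
  by (auto simp: configs_def PiE_iff extensional_def)

lemma configs_in_Zmod: "g \<in> configs d K \<Longrightarrow> i \<in> K \<Longrightarrow> g i \<in> Zmod d"
  by (auto simp: configs_def)

lemma ket_in_l2: "g \<in> configs d K \<Longrightarrow> ket g \<in> l2 d K"
  by (auto simp: ket_def l2_def)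

lemma linear_l2D: "linear_l2 d K L T \<Longrightarrow> \<psi> \<in> l2 d K \<Longrightarrow> T \<psi> \<in> l2 d L"
  by (auto simp: linear_l2_def)

lemma linear_l2_sum:
  assumes "linear_l2 d K L T" and "\<And>a. a \<in> A \<Longrightarrow> B a \<in> l2 d K"
  shows "T (\<lambda>x. \<Sum>a\<in>A. c a * B a x) = (\<lambda>x. \<Sum>a\<in>A. c a * T (B a) x)"
proof -
  have scale: "T (\<lambda>x. c * \<psi> x) = (\<lambda>x. c * T \<psi> x)" if "\<psi> \<in> l2 d K" for c \<psi>
    using assms(1) that by (simp add: linear_l2_def)
  have add: "T (\<lambda>x. \<phi> x + \<psi> x) = (\<lambda>x. T \<phi> x + T \<psi> x)" if "\<phi> \<in> l2 d K" "\<psi> \<in> l2 d K" for \<phi> \<psi>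
    using assms(1) that by (simp add: linear_l2_def)
  \<comment> \<open>Covers both the empty and the infinite index set, whose sums are 0.\<close>
  have zero: "T (\<lambda>x. 0) = (\<lambda>x. 0)"
    using scale[of "\<lambda>x. 0" 0] by (simp add: l2_def)
  show ?thesis
    using assms(2)
  proof (induction A rule: infinite_finite_induct)
    case (insert a A)
    have "(\<lambda>x. c a * B a x) \<in> l2 d K" "(\<lambda>x. \<Sum>a\<in>A. c a * B a x) \<in> l2 d K"
      using insert.prems by (auto simp: l2_def)
    then show ?case
      using insert add[of "\<lambda>x. c a * B a x" "\<lambda>x. \<Sum>a\<in>A. c a * B a x"] scale[of "B a"] by simp
  qed (use zero in auto)
qed

text \<open>\<open>rows\<close> makes the conjugate transpose of the matrix a left inverse and
  \<open>cols\<close> makes it a right inverse; bijectivity follows, and preservation of the inner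
  product follows from the left inverse.\<close>

lemma unitary_l2_lin_ext:
  assumes "finite K"
    and in_l2: "\<And>g. g \<in> configs d K \<Longrightarrow> B g \<in> l2 d K"
    and rows: "\<And>g g'. g \<in> configs d K \<Longrightarrow> g' \<in> configs d K \<Longrightarrow>
      (\<Sum>x\<in>configs d K. cnj (B g x) * B g' x) = (if g = g' then 1 else 0)"
    and cols: "\<And>x x'. x \<in> configs d K \<Longrightarrow> x' \<in> configs d K \<Longrightarrow>
      (\<Sum>g\<in>configs d K. cnj (B g x) * B g x') = (if x = x' then 1 else 0)"
  shows "unitary_l2 d K (lin_ext d K B)"
proof -
  let ?C = "configs d K"
  define T where "T = lin_ext d K B"
  \<comment> \<open>The conjugate transpose of \<open>T\<close>, cut off to 0 outside the basis
    labels so that its values lie in \<open>l2 d K\<close>.\<close>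
  define S where "S = (\<lambda>\<phi> g. if g \<in> ?C then \<Sum>x\<in>?C. cnj (B g x) * \<phi> x else 0 :: complex)"
  have fin: "finite ?C" using assms(1) by (rule finite_configs)
  have lin: "linear_l2 d K K T"
    unfolding T_def using in_l2 by (rule linear_l2_lin_ext)
  have T_in: "T \<psi> \<in> l2 d K" if "\<psi> \<in> l2 d K" for \<psi>
    using lin that by (rule linear_l2D)
  have S_in: "S \<phi> \<in> l2 d K" for \<phi>
    by (simp add: S_def l2_def)
  have ST: "S (T \<psi>) = \<psi>" if "\<psi> \<in> l2 d K" for \<psi>
  proof
    fix g
    show "S (T \<psi>) g = \<psi> g"
    proof (cases "g \<in> ?C")
      case True
      have "S (T \<psi>) g = (\<Sum>x\<in>?C. \<Sum>g'\<in>?C. \<psi> g' * (cnj (B g x) * B g' x))"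
        using True by (simp add: S_def T_def lin_ext_def sum_distrib_left mult_ac)
      also have "\<dots> = (\<Sum>g'\<in>?C. \<psi> g' * (\<Sum>x\<in>?C. cnj (B g x) * B g' x))"
        by (subst sum.swap) (simp add: sum_distrib_left)
      also have "\<dots> = (\<Sum>g'\<in>?C. if g' = g then \<psi> g' else 0)"
        using True by (intro sum.cong) (auto simp: rows)
      also have "\<dots> = \<psi> g"
        using True fin by simp
      finally show ?thesis .
    next
      case False
      then show ?thesis using that by (simp add: S_def l2_def)
    qed
  qed
  have TS: "T (S \<phi>) = \<phi>" if "\<phi> \<in> l2 d K" for \<phi>
  proof
    fix x
    show "T (S \<phi>) x = \<phi> x"
    proof (cases "x \<in> ?C")
      case True
      have "T (S \<phi>) x = (\<Sum>g\<in>?C. \<Sum>x'\<in>?C. \<phi> x' * (cnj (B g x') * B g x))"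
        by (simp add: S_def T_def lin_ext_def sum_distrib_left mult_ac)
      also have "\<dots> = (\<Sum>x'\<in>?C. \<phi> x' * (\<Sum>g\<in>?C. cnj (B g x') * B g x))"
        by (subst sum.swap) (simp add: sum_distrib_left)
      also have "\<dots> = (\<Sum>x'\<in>?C. if x' = x then \<phi> x' else 0)"
        using True by (intro sum.cong) (auto simp: cols)
      also have "\<dots> = \<phi> x"
        using True fin by simp
      finally show ?thesis .
    next
      case False
      then show ?thesis using that T_in[OF S_in, of \<phi>] by (simp add: l2_def)
    qed
  qed
  have "bij_betw T (l2 d K) (l2 d K)"
    by (rule bij_betw_byWitness[of _ S]) (use ST TS T_in S_in in auto)
  moreover have "l2_inner d K (T \<phi>) (T \<psi>) = l2_inner d K \<phi> \<psi>"
    if "\<phi> \<in> l2 d K" "\<psi> \<in> l2 d K" for \<phi> \<psi>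
  proof -
    have T_x: "T \<phi> x = (\<Sum>g\<in>?C. \<phi> g * B g x)" for x
      by (simp add: T_def lin_ext_def)
    \<comment> \<open>\<open>S\<close> is the adjoint of \<open>T\<close>: the left side becomes the
      inner product of \<open>\<phi>\<close> with \<open>S (T \<psi>)\<close>, which is
      \<open>\<psi>\<close>.\<close>
    have "l2_inner d K (T \<phi>) (T \<psi>) =
        (\<Sum>x\<in>?C. \<Sum>g\<in>?C. cnj (\<phi> g) * (cnj (B g x) * T \<psi> x))"
      unfolding l2_inner_def by (intro sum.cong refl) (subst T_x, simp add: sum_distrib_left mult_ac)
    also have "\<dots> = (\<Sum>g\<in>?C. cnj (\<phi> g) * (\<Sum>x\<in>?C. cnj (B g x) * T \<psi> x))"
      by (subst sum.swap) (simp add: sum_distrib_left)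
    also have "\<dots> = (\<Sum>g\<in>?C. cnj (\<phi> g) * S (T \<psi>) g)"
      by (intro sum.cong) (simp_all add: S_def)
    also have "\<dots> = l2_inner d K \<phi> \<psi>"
      using ST[OF that(2)] by (simp add: l2_inner_def)
    finally show ?thesis .
  qed
  ultimately show ?thesis
    using lin by (simp add: unitary_l2_def T_def)
qed

lemma unitary_l2_comp: "unitary_l2 d K S \<Longrightarrow> unitary_l2 d K T \<Longrightarrow> unitary_l2 d K (S \<circ> T)"
  unfolding unitary_l2_def
  by (intro conjI; (elim conjE)?; (rule bij_betw_trans; assumption)?)
    (auto simp: linear_l2_def Pi_iff)

lemma foldr_comp_Cons: "foldr (\<circ>) (T # gs) id = T \<circ> foldr (\<circ>) gs id"
  by simp

lemma unitary_l2_foldr: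
  "(\<And>T. T \<in> set gs \<Longrightarrow> unitary_l2 d K T) \<Longrightarrow> unitary_l2 d K (foldr (\<circ>) gs id)"
proof (induction gs)
  case Nil
  then show ?case by (simp add: unitary_l2_def linear_l2_def bij_betw_def)
next
  case (Cons T gs)
  show ?case
    unfolding foldr_comp_Cons by (intro unitary_l2_comp Cons.IH) (use Cons.prems in auto)
qed

text \<open>In a gate list the head acts last, so the gates of \<open>ys\<close> act before those of
  \<open>xs\<close>.\<close>

lemma foldr_comp_append: "foldr (\<circ>) (xs @ ys) id = foldr (\<circ>) xs id \<circ> foldr (\<circ>) ys id"
  by (induction xs) auto

section \<open>Controlled shifts\<close>

context
  fixes d :: nat and Y :: "nat set" and i j :: nat and m :: int
  assumes d: "d > 0" and Y: "finite Y" "i \<in> Y" "j \<in> Y" "i \<noteq> j"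
begin

abbreviation "shift \<equiv> \<lambda>g::config. g(j := (g j + m * g i) mod int d)"
abbreviation "unshift \<equiv> \<lambda>g::config. g(j := (g j - m * g i) mod int d)"

lemma shift_eq_iff:
  assumes "g \<in> configs d Y" "x \<in> configs d Y"
  shows "shift g = x \<longleftrightarrow> g = unshift x"
proof -
  \<comment> \<open>Digits are reduced residues, so equality of digits is the same as congruence mod
    \<open>d\<close>.\<close>
  have "g j mod int d = g j" "x j mod int d = x j"
    using configs_in_Zmod[OF assms(1) Y(3)] configs_in_Zmod[OF assms(2) Y(3)] by (auto simp: Zmod_def)
  moreover have "(g j + m * a) mod int d = x j mod int d \<longleftrightarrow> g j mod int d = (x j - m * a) mod int d" for a
    by (simp add: mod_eq_dvd_iff algebra_simps)
  ultimately have "(g j + m * a) mod int d = x j \<longleftrightarrow> g j = (x j - m * a) mod int d" for a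
    by simp
  moreover have "shift g = x \<longleftrightarrow> (\<forall>k. k \<noteq> j \<longrightarrow> g k = x k) \<and> (g j + m * g i) mod int d = x j"
    unfolding fun_eq_iff by auto
  moreover have "g = unshift x \<longleftrightarrow> (\<forall>k. k \<noteq> j \<longrightarrow> g k = x k) \<and> g j = (x j - m * x i) mod int d"
    unfolding fun_eq_iff by auto
  \<comment> \<open>Agreement off \<open>j\<close> includes the control digit because
    \<open>i \<noteq> j\<close>, so \<open>g i\<close> and \<open>x i\<close> are
    interchangeable.\<close>
  ultimately show ?thesis using Y(4) by metis
qed

lemma unshift_in_configs: "x \<in> configs d Y \<Longrightarrow> unshift x \<in> configs d Y"
  using Y by (intro configs_upd mod_in_Zmod d)

lemma shift_in_configs: "x \<in> configs d Y \<Longrightarrow> shift x \<in> configs d Y"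
  using Y by (intro configs_upd mod_in_Zmod d)

text \<open>The gate permutes basis labels, hence acts on wave functions by pullback along the
  inverse permutation.\<close>

lemma cshift_gate_apply:
  assumes "x \<in> configs d Y"
  shows "cshift_gate d Y i j m \<psi> x = \<psi> (unshift x)"
proof -
  have "cshift_gate d Y i j m \<psi> x = (\<Sum>g\<in>configs d Y. if g = unshift x then \<psi> g else 0)"
    unfolding cshift_gate_def lin_ext_def ket_def
    using shift_eq_iff[OF _ assms] by (intro sum.cong) (auto simp: eq_commute[of x])
  then show ?thesis
    using unshift_in_configs[OF assms] finite_configs[OF Y(1)] by simp
qed

text \<open>A permutation matrix: each orthogonality sum has one surviving term, evaluated by
  injectivity of \<open>shift\<close> for the rows and by its right inverse \<open>unshift\<close>
  for the columns.\<close>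

lemma unitary_cshift_gate: "unitary_l2 d Y (cshift_gate d Y i j m)"
  unfolding cshift_gate_def
proof (rule unitary_l2_lin_ext)
  note fin = finite_configs[OF Y(1), of d]
  fix g g'
  assume g: "g \<in> configs d Y" and g': "g' \<in> configs d Y"
  show "ket (shift g) \<in> l2 d Y"
    using g by (intro ket_in_l2 shift_in_configs)
  have "(\<Sum>x\<in>configs d Y. cnj (ket (shift g) x) * ket (shift g') x) =
      (\<Sum>x\<in>configs d Y. if x = shift g then ket (shift g') x else 0)"
    by (intro sum.cong) (auto simp: ket_def)
  also have "\<dots> = (if shift g = shift g' then 1 else 0)"
    using shift_in_configs[OF g] fin by (simp add: ket_def)
  also have "shift g = shift g' \<longleftrightarrow> g = g'"
  proof -
    have e: "g' = unshift (shift g')"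
      by (rule iffD1[OF shift_eq_iff[OF g' shift_in_configs[OF g']] refl])
    show ?thesis
      unfolding shift_eq_iff[OF g shift_in_configs[OF g']] by (simp only: e[symmetric])
  qed
  finally show "(\<Sum>x\<in>configs d Y. cnj (ket (shift g) x) * ket (shift g') x) =
    (if g = g' then 1 else 0)" .
  have "(\<Sum>x\<in>configs d Y. cnj (ket (shift x) g) * ket (shift x) g') =
      (\<Sum>x\<in>configs d Y. if x = unshift g then ket (shift x) g' else 0)"
    using shift_eq_iff[OF _ g] by (intro sum.cong) (auto simp: ket_def eq_commute[of g])
  also have "\<dots> = ket (shift (unshift g)) g'"
    using unshift_in_configs[OF g] fin by simp
  also have "shift (unshift g) = g"
    by (rule iffD2[OF shift_eq_iff[OF unshift_in_configs[OF g] g] refl])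
  also have "ket g g' = (if g = g' then 1 else 0)"
    by (auto simp: ket_def)
  finally show "(\<Sum>x\<in>configs d Y. cnj (ket (shift x) g) * ket (shift x) g') =
    (if g = g' then 1 else 0)" .
qed (rule Y)

end

text \<open>The control \<open>c\<close> is never a target and the targets are distinct, so the
  shifts do not interfere and act as if simultaneous.\<close>

lemma foldr_cshift_gates_apply:
  fixes m :: "nat \<Rightarrow> int"
  assumes "d > 0" "finite Y" "c \<in> Y" "set js \<subseteq> Y" "c \<notin> set js" "distinct js"
    and "x \<in> configs d Y"
  shows "foldr (\<circ>) (map (\<lambda>j. cshift_gate d Y c j (m j)) js) id \<psi> x =
    \<psi> (\<lambda>i. if i \<in> set js then (x i - m i * x c) mod int d else x i)"
  using assms
proof (induction js arbitrary: x)
  case Nil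
  then show ?case by simp
next
  case (Cons j js)
  let ?x = "x(j := (x j - m j * x c) mod int d)"
  have j: "j \<in> Y" "c \<noteq> j" "j \<notin> set js" using Cons.prems by auto
  have x: "?x \<in> configs d Y"
    using Cons.prems by (intro configs_upd mod_in_Zmod) auto
  have "foldr (\<circ>) (map (\<lambda>j. cshift_gate d Y c j (m j)) (j # js)) id \<psi> x =
      foldr (\<circ>) (map (\<lambda>j. cshift_gate d Y c j (m j)) js) id \<psi> ?x"
    using cshift_gate_apply[of d Y c j x "m j"] Cons.prems j by simp
  also have "\<dots> = \<psi> (\<lambda>i. if i \<in> set js then (?x i - m i * ?x c) mod int d else ?x i)"
    by (intro Cons.IH x) (use Cons.prems in auto)
  also have "(\<lambda>i. if i \<in> set js then (?x i - m i * ?x c) mod int d else ?x i) =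
      (\<lambda>i. if i \<in> set (j # js) then (x i - m i * x c) mod int d else x i)"
    using j by (auto simp: fun_eq_iff)
  finally show ?case .
qed

section \<open>Fourier transforms\<close>

text \<open>Either side says that \<open>g\<close> and \<open>x\<close> agree away from
  \<open>i\<close>, a symmetric relation.\<close>

lemma fun_upd_eq_swap: "g(i := x i) = x \<longleftrightarrow> x(i := g i) = g"
  by (metis fun_upd_triv fun_upd_upd)

text \<open>The labels agreeing with \<open>x\<close> off \<open>i\<close> are parametrised by their
  digit at \<open>i\<close>, which reduces a sum over all labels to one over residues.\<close>

lemma sum_configs_fiber:
  assumes "finite Y" "i \<in> Y" "x \<in> configs d Y"
  shows "(\<Sum>g\<in>configs d Y. if g(i := x i) = x then f g else 0) = (\<Sum>a\<in>Zmod d. f (x(i := a)))"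
proof -
  have "(\<Sum>g\<in>configs d Y. if g(i := x i) = x then f g else 0) =
      sum f {g \<in> configs d Y. g(i := x i) = x}"
    using finite_configs[OF assms(1)] by (simp add: sum.inter_filter)
  also have "{g \<in> configs d Y. g(i := x i) = x} = (\<lambda>a. x(i := a)) ` Zmod d"
  proof (intro equalityI subsetI)
    fix g assume "g \<in> {g \<in> configs d Y. g(i := x i) = x}"
    then have "x(i := g i) = g" "g i \<in> Zmod d"
      using configs_in_Zmod[OF _ assms(2), of g d] fun_upd_eq_swap[of g i x] by auto
    then show "g \<in> (\<lambda>a. x(i := a)) ` Zmod d" by (metis imageI)
  next
    fix g assume "g \<in> (\<lambda>a. x(i := a)) ` Zmod d"
    then show "g \<in> {g \<in> configs d Y. g(i := x i) = x}"
      using assms by (auto intro: configs_upd)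
  qed
  also have "sum f \<dots> = (\<Sum>a\<in>Zmod d. f (x(i := a)))"
    by (subst sum.reindex) (auto simp: inj_on_def fun_eq_iff)
  finally show ?thesis .
qed

text \<open>Only the term \<open>h = x i\<close> can survive; the result is the matrix entry of the
  Fourier gate before normalization.\<close>

lemma fourier_kernel:
  assumes "i \<in> Y" "x \<in> configs d Y"
  shows "(\<Sum>h\<in>Zmod d. \<chi> d (g i) h * ket (g(i := h)) x) =
    (if g(i := x i) = x then \<chi> d (g i) (x i) else 0)"
proof -
  have "(\<Sum>h\<in>Zmod d. \<chi> d (g i) h * ket (g(i := h)) x) =
      (\<Sum>h\<in>Zmod d. if h = x i then (if g(i := h) = x then \<chi> d (g i) h else 0) else 0)"
    by (intro sum.cong) (auto simp: ket_def)
  then show ?thesis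
    using configs_in_Zmod[OF assms(2,1)] by (simp add: Zmod_def)
qed

lemma fourier_gate_apply:
  assumes "finite Y" "i \<in> Y" "x \<in> configs d Y"
  shows "fourier_gate d Y i \<psi> x =
    of_real (1 / sqrt (real d)) * (\<Sum>a\<in>Zmod d. \<chi> d a (x i) * \<psi> (x(i := a)))"
proof -
  have "fourier_gate d Y i \<psi> x = of_real (1 / sqrt (real d)) *
      (\<Sum>g\<in>configs d Y. if g(i := x i) = x then \<chi> d (g i) (x i) * \<psi> g else 0)"
    unfolding fourier_gate_def lin_ext_def sum_distrib_left[of "of_real (1 / sqrt (real d))" _ "configs d Y"]
  proof (intro sum.cong refl)
    fix g
    show "\<psi> g * (of_real (1 / sqrt (real d)) * (\<Sum>h\<in>Zmod d. \<chi> d (g i) h * ket (g(i := h)) x)) =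
      of_real (1 / sqrt (real d)) * (if g(i := x i) = x then \<chi> d (g i) (x i) * \<psi> g else 0)"
      unfolding fourier_kernel[OF assms(2,3), where g = g] by simp
  qed
  then show ?thesis
    by (simp add: sum_configs_fiber[OF assms])
qed

text \<open>Row orthogonality is character orthogonality in the digit at \<open>i\<close>; column
  orthogonality follows because the matrix is symmetric.\<close>

lemma unitary_fourier_gate:
  assumes d: "d > 0" and Y: "finite Y" "i \<in> Y"
  shows "unitary_l2 d Y (fourier_gate d Y i)"
proof -
  let ?s = "of_real (1 / sqrt (real d)) :: complex"
  define B where "B = (\<lambda>g x. ?s * (\<Sum>h\<in>Zmod d. \<chi> d (g i) h * ket (g(i := h)) x))"
  have B: "B g x = (if g(i := x i) = x then ?s * \<chi> d (g i) (x i) else 0)"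
    if "x \<in> configs d Y" for g x
    using fourier_kernel[OF Y(2) that] by (simp add: B_def)
  have s: "?s * ?s * of_nat d = 1"
  proof -
    have "1 / sqrt (real d) * (1 / sqrt (real d)) * real d = 1"
      using d by simp
    then show ?thesis by (metis of_real_1 of_real_mult of_real_of_nat_eq)
  qed
  have B_sym: "B g x = B x g" if "g \<in> configs d Y" "x \<in> configs d Y" for g x
    using that by (simp add: B \<chi>_commute fun_upd_eq_swap[of g])
  have rows: "(\<Sum>x\<in>configs d Y. cnj (B g x) * B g' x) = (if g = g' then 1 else 0)"
    if g: "g \<in> configs d Y" and g': "g' \<in> configs d Y" for g g'
  proof -
    have "(\<Sum>x\<in>configs d Y. cnj (B g x) * B g' x) =
        (\<Sum>x\<in>configs d Y. if x(i := g i) = g then cnj (?s * \<chi> d (g i) (x i)) * B g' x else 0)"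
      by (intro sum.cong) (simp_all add: B fun_upd_eq_swap[of g])
    also have "\<dots> = (\<Sum>a\<in>Zmod d. cnj (?s * \<chi> d (g i) a) * B g' (g(i := a)))"
      by (simp add: sum_configs_fiber[OF Y g])
    \<comment> \<open>The supports of two rows meet only if \<open>g\<close> and \<open>g'\<close>
      agree off \<open>i\<close>; there the conjugated phase and the other phase combine into one
      character of the difference.\<close>
    also have "\<dots> = (\<Sum>a\<in>Zmod d. if g'(i := g i) = g then ?s * ?s * \<chi> d (g' i - g i) a else 0)"
    proof (intro sum.cong refl)
      fix a assume "a \<in> Zmod d"
      then have "g(i := a) \<in> configs d Y" using g Y by (intro configs_upd)
      moreover have "g'(i := a) = g(i := a) \<longleftrightarrow> g'(i := g i) = g"
        by (auto simp: fun_eq_iff)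
      ultimately show "cnj (?s * \<chi> d (g i) a) * B g' (g(i := a)) =
          (if g'(i := g i) = g then ?s * ?s * \<chi> d (g' i - g i) a else 0)"
        using \<chi>_add[of d "g' i" "- g i" a] by (simp add: B cnj_\<chi>)
    qed
    also have "\<dots> = (if g'(i := g i) = g then ?s * ?s * (\<Sum>a\<in>Zmod d. \<chi> d (g' i - g i) a) else 0)"
      by (simp add: sum_distrib_left)
    also have "(\<Sum>a\<in>Zmod d. \<chi> d (g' i - g i) a) = (if g' i = g i then of_nat d else 0)"
      using sum_Zmod_\<chi>[OF d] Zmod_dvd_diff_iff[OF configs_in_Zmod[OF g' Y(2)] configs_in_Zmod[OF g Y(2)]]
      by simp
    also have "(if g'(i := g i) = g then ?s * ?s * (if g' i = g i then of_nat d else 0) else 0) =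
        (if g = g' then 1 else 0)"
    proof -
      have "g'(i := g i) = g \<and> g' i = g i \<longleftrightarrow> g = g'"
        by (metis fun_upd_triv)
      then show ?thesis using s by auto
    qed
    finally show ?thesis .
  qed
  have cols: "(\<Sum>g\<in>configs d Y. cnj (B g x) * B g x') = (if x = x' then 1 else 0)"
    if x: "x \<in> configs d Y" and x': "x' \<in> configs d Y" for x x'
    unfolding rows[OF that, symmetric] using that by (intro sum.cong) (simp_all add: B_sym)
  have "B g \<in> l2 d Y" if "g \<in> configs d Y" for g
    using configs_upd[OF that Y(2)] by (auto simp: l2_def B_def ket_def intro!: sum.neutral)
  then have "unitary_l2 d Y (lin_ext d Y B)"
    using Y rows cols by (intro unitary_l2_lin_ext)
  then show ?thesis
    by (simp add: fourier_gate_def B_def)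
qed

lemma unitary_elementary_gate:
  assumes "d > 0" "finite Y" "T \<in> elementary_gates d Y"
  shows "unitary_l2 d Y T"
  using assms by (auto simp: elementary_gates_def intro: unitary_cshift_gate unitary_fourier_gate)

section \<open>Partially encoded states\<close>

text \<open>The stage \<open>k\<close> state of the idea above. The update at 0 lets vertex 0, which
  is no output digit, carry the input \<open>h\<close>; the condition on \<open>j > k\<close> pins
  those digits to the stored sums, and each Fourier transform contributes one factor 1 / sqrt
  d.\<close>

definition partial_code :: "nat \<Rightarrow> nat \<Rightarrow> (nat \<Rightarrow> nat \<Rightarrow> int) \<Rightarrow> int \<Rightarrow> nat \<Rightarrow> state" where
  "partial_code d n \<Gamma> h k x =
     (if x \<in> configs d {1..n} \<and>
         (\<forall>j\<in>{k<..n}. x j = (\<Sum>i\<le>k. \<Gamma> i j * (x(0 := h)) i) mod int d)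
      then of_real ((1 / sqrt (real d)) ^ k) *
        (\<Prod>j\<le>k. \<Prod>i<j. \<chi> d ((x(0 := h)) i) ((x(0 := h)) j) powi \<Gamma> i j)
      else 0)"

text \<open>Here \<open>k\<close> is the graph vertex whose edges are processed and \<open>c\<close>
  the digit holding its value. They coincide except at stage 0, where digit 1 holds the value of
  vertex 0; starting after \<open>c\<close> then skips the edge {0,1}.\<close>

definition targets :: "nat \<Rightarrow> (nat \<Rightarrow> nat \<Rightarrow> int) \<Rightarrow> nat \<Rightarrow> nat \<Rightarrow> nat list" where
  "targets n \<Gamma> k c = filter (\<lambda>j. \<Gamma> k j \<noteq> 0) [Suc c..<Suc n]"

definition shifts :: "nat \<Rightarrow> nat \<Rightarrow> (nat \<Rightarrow> nat \<Rightarrow> int) \<Rightarrow> nat \<Rightarrow> nat \<Rightarrow> (state \<Rightarrow> state) list" where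
  "shifts d n \<Gamma> k c = map (\<lambda>j. cshift_gate d {1..n} c j (\<Gamma> k j)) (targets n \<Gamma> k c)"

lemma set_targets: "set (targets n \<Gamma> k c) = {j \<in> {c<..n}. \<Gamma> k j \<noteq> 0}"
  by (auto simp: targets_def)

lemma length_targets: "length (targets n \<Gamma> k c) = card {j \<in> {c<..n}. \<Gamma> k j \<noteq> 0}"
proof -
  have "distinct (targets n \<Gamma> k c)" by (simp add: targets_def del: upt_Suc)
  then show ?thesis using distinct_card set_targets by metis
qed

lemma shifts_elementary: "c \<in> {1..n} \<Longrightarrow> set (shifts d n \<Gamma> k c) \<subseteq> elementary_gates d {1..n}"
proof
  fix T assume c: "c \<in> {1..n}" and "T \<in> set (shifts d n \<Gamma> k c)"
  then obtain j where "T = cshift_gate d {1..n} c j (\<Gamma> k j)" "j \<in> set (targets n \<Gamma> k c)"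
    unfolding shifts_def by auto
  moreover from this c have "j \<in> {1..n}" "c \<noteq> j" by (auto simp: set_targets)
  ultimately show "T \<in> elementary_gates d {1..n}"
    unfolding elementary_gates_def using c by blast
qed

text \<open>The formula may range over all digits above \<open>c\<close>, since a shift with weight
  0 leaves a reduced residue unchanged.\<close>

lemma shifts_apply:
  assumes "d > 0" "c \<in> {1..n}" "x \<in> configs d {1..n}"
  shows "foldr (\<circ>) (shifts d n \<Gamma> k c) id \<psi> x =
    \<psi> (\<lambda>j. if j \<in> {c<..n} then (x j - \<Gamma> k j * x c) mod int d else x j)"
proof -
  have "foldr (\<circ>) (shifts d n \<Gamma> k c) id \<psi> x =
    \<psi> (\<lambda>j. if j \<in> set (targets n \<Gamma> k c) then (x j - \<Gamma> k j * x c) mod int d else x j)"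
    unfolding shifts_def
    using assms by (intro foldr_cshift_gates_apply) (auto simp: set_targets, simp add: targets_def del: upt_Suc)
  also have "(\<lambda>j. if j \<in> set (targets n \<Gamma> k c) then (x j - \<Gamma> k j * x c) mod int d else x j) =
      (\<lambda>j. if j \<in> {c<..n} then (x j - \<Gamma> k j * x c) mod int d else x j)"
  proof
    fix j
    show "(if j \<in> set (targets n \<Gamma> k c) then (x j - \<Gamma> k j * x c) mod int d else x j) =
      (if j \<in> {c<..n} then (x j - \<Gamma> k j * x c) mod int d else x j)"
      using configs_in_Zmod[OF assms(3), of j] assms(2) by (auto simp: set_targets Zmod_def)
  qed
  finally show ?thesis .
qed

lemma shifts_l2:
  assumes "d > 0" "c \<in> {1..n}" "\<psi> \<in> l2 d {1..n}"
  shows "foldr (\<circ>) (shifts d n \<Gamma> k c) id \<psi> \<in> l2 d {1..n}"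
proof -
  have "unitary_l2 d {1..n} (foldr (\<circ>) (shifts d n \<Gamma> k c) id)"
    using shifts_elementary[OF assms(2)] assms(1)
    by (intro unitary_l2_foldr unitary_elementary_gate) auto
  then show ?thesis
    using assms(3) by (auto simp: unitary_l2_def intro: linear_l2D)
qed

lemma l2_eqI:
  assumes "\<phi> \<in> l2 d K" "\<psi> \<in> l2 d K" "\<And>x. x \<in> configs d K \<Longrightarrow> \<phi> x = \<psi> x"
  shows "\<phi> = \<psi>"
proof
  fix x
  show "\<phi> x = \<psi> x" using assms by (cases "x \<in> configs d K") (auto simp: l2_def)
qed

lemma partial_code_l2: "partial_code d n \<Gamma> h k \<in> l2 d {1..n}"
  by (simp add: l2_def partial_code_def)

lemma partial_code_0:
  assumes "d > 0" "n > 0" "h \<in> Zmod d" "\<Gamma> 0 1 = 1"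
  shows "foldr (\<circ>) (shifts d n \<Gamma> 0 1) id (ket (\<lambda>i\<in>{1..n}. if i = 1 then h else 0)) =
    partial_code d n \<Gamma> h 0"
proof (rule l2_eqI)
  let ?k = "\<lambda>i\<in>{1..n}. if i = 1 then h else 0"
  have "?k \<in> configs d {1..n}"
    using assms by (auto simp: configs_def Zmod_def)
  then show "foldr (\<circ>) (shifts d n \<Gamma> 0 1) id (ket ?k) \<in> l2 d {1..n}"
    using assms by (intro shifts_l2 ket_in_l2) auto
  fix x assume x: "x \<in> configs d {1..n}"
  \<comment> \<open>The label that the shifts carry to \<open>x\<close>; the amplitude at
    \<open>x\<close> is nonzero iff this is the initial label.\<close>
  define x' where "x' = (\<lambda>j. if j \<in> {1<..n} then (x j - \<Gamma> 0 j * x 1) mod int d else x j)"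
  have Z: "x j mod int d = x j" if "j \<in> {1..n}" for j
    using configs_in_Zmod[OF x that] by (simp add: Zmod_def)
  have h: "h mod int d = h" using assms(3) by (simp add: Zmod_def)
  have Y: "{1..n} = insert 1 {1<..n}" using assms(2) by auto
  have outside: "x' j = ?k j" if "j \<notin> {1..n}" for j
    using x that by (auto simp: x'_def configs_def PiE_iff extensional_def)
  have "x' = ?k \<longleftrightarrow> (\<forall>j\<in>{1..n}. x' j = ?k j)"
    unfolding fun_eq_iff using outside by blast
  also have "\<dots> \<longleftrightarrow> (\<forall>j\<in>{1..n}. x' j = (if j = 1 then h else 0))"
    by (intro ball_cong refl) simp
  also have "\<dots> \<longleftrightarrow> x 1 = h \<and> (\<forall>j\<in>{1<..n}. x' j = 0)"
    unfolding Y by (auto simp: x'_def)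
  also have "\<dots> \<longleftrightarrow> x 1 = h \<and> (\<forall>j\<in>{1<..n}. (x j - \<Gamma> 0 j * h) mod int d = 0)"
    by (intro conj_cong ball_cong refl) (simp add: x'_def)
  also have "\<dots> \<longleftrightarrow> x 1 = h \<and> (\<forall>j\<in>{1<..n}. x j = (\<Gamma> 0 j * h) mod int d)"
  proof -
    have "(x j - \<Gamma> 0 j * h) mod int d = 0 \<longleftrightarrow> x j = (\<Gamma> 0 j * h) mod int d"
      if "j \<in> {1<..n}" for j
    proof -
      have "(x j - \<Gamma> 0 j * h) mod int d = 0 \<longleftrightarrow> x j mod int d = (\<Gamma> 0 j * h) mod int d"
        by (simp only: mod_eq_dvd_iff mod_eq_0_iff_dvd)
      then show ?thesis using Z[of j] that by simp
    qed
    then show ?thesis by simp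
  qed
  \<comment> \<open>Since \<open>\<Gamma> 0 1 = 1\<close>, the condition \<open>x 1 = h\<close> is
    the storage condition at digit 1.\<close>
  also have "\<dots> \<longleftrightarrow> (\<forall>j\<in>{0<..n}. x j = (\<Gamma> 0 j * h) mod int d)"
  proof -
    have "{0<..n} = insert 1 {1<..n}" using assms(2) by auto
    then show ?thesis using assms(4) h by simp
  qed
  finally have "x' = ?k \<longleftrightarrow> (\<forall>j\<in>{0<..n}. x j = (\<Gamma> 0 j * h) mod int d)" .
  then have "ket ?k x' = partial_code d n \<Gamma> h 0 x"
    using x by (simp add: ket_def partial_code_def)
  then show "foldr (\<circ>) (shifts d n \<Gamma> 0 1) id (ket ?k) x = partial_code d n \<Gamma> h 0 x"
    using shifts_apply[OF assms(1) _ x, of 1] assms(2) by (simp add: x'_def)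
qed (rule partial_code_l2)

text \<open>The amplitude at \<open>x\<close> is traced backwards: after undoing the shifts, the
  Fourier sum over the old digit \<open>a\<close> at \<open>Suc k\<close> has at most one nonzero
  term, where \<open>a\<close> is the stored value.\<close>

lemma partial_code_Suc:
  assumes d: "d > 0" and k: "Suc k \<le> n"
  shows "foldr (\<circ>) (shifts d n \<Gamma> (Suc k) (Suc k) @ [fourier_gate d {1..n} (Suc k)]) id
      (partial_code d n \<Gamma> h k) = partial_code d n \<Gamma> h (Suc k)"
proof -
  let ?Y = "{1..n}" and ?K = "Suc k"
  let ?P = "partial_code d n \<Gamma> h"
  have K: "?K \<in> ?Y" using k by simp
  have F_in: "fourier_gate d ?Y ?K (?P k) \<in> l2 d ?Y"
    using unitary_fourier_gate[OF d _ K] partial_code_l2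
    by (auto simp: unitary_l2_def intro: linear_l2D)
  have "foldr (\<circ>) (shifts d n \<Gamma> ?K ?K) id (fourier_gate d ?Y ?K (?P k)) = ?P ?K"
  proof (rule l2_eqI)
    show "foldr (\<circ>) (shifts d n \<Gamma> ?K ?K) id (fourier_gate d ?Y ?K (?P k)) \<in> l2 d ?Y"
      using d K F_in by (rule shifts_l2)
    fix x assume x: "x \<in> configs d ?Y"
    define x' where "x' = (\<lambda>j. if j \<in> {?K<..n} then (x j - \<Gamma> ?K j * x ?K) mod int d else x j)"
    define y where "y = x(0 := h)"
    \<comment> \<open>The numbers stored after stage \<open>k\<close>, before reduction;
      \<open>W\<close> is the amplitude of that stage.\<close>
    define b where "b = (\<lambda>j. \<Sum>i\<le>k. \<Gamma> i j * y i)"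
    define W where "W = of_real ((1 / sqrt (real d)) ^ k) * (\<Prod>j\<le>k. \<Prod>i<j. \<chi> d (y i) (y j) powi \<Gamma> i j)"
    have x': "x' \<in> configs d ?Y"
      using x d K by (auto simp: x'_def configs_def PiE_iff extensional_def Zmod_def)
    \<comment> \<open>Neither the shifts nor the choice of \<open>a\<close> touch vertices up to
      \<open>k\<close>, so \<open>b\<close> and \<open>W\<close> do not depend on
      \<open>a\<close>.\<close>
    have y_low: "((x'(?K := a))(0 := h)) i = y i" if "i \<le> k" for i a
      using that by (auto simp: x'_def y_def)
    have Z: "x j mod int d = x j" if "j \<in> ?Y" for j
      using configs_in_Zmod[OF x that] by (simp add: Zmod_def)
    \<comment> \<open>The support condition of stage \<open>Suc k\<close>: undoing the shifts moves
      the contribution of vertex \<open>Suc k\<close> to the other side of the congruence.\<close>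
    let ?Q = "\<forall>j\<in>{?K<..n}. x j = (b j + \<Gamma> ?K j * y ?K) mod int d"
    have step: "?P k (x'(?K := a)) = (if a = b ?K mod int d then if ?Q then W else 0 else 0)"
      if a: "a \<in> Zmod d" for a
    proof -
      have in_C: "x'(?K := a) \<in> configs d ?Y"
        using x' K a by (intro configs_upd)
      have b: "(\<Sum>i\<le>k. \<Gamma> i j * ((x'(?K := a))(0 := h)) i) = b j" for j
        unfolding b_def by (intro sum.cong refl) (simp only: y_low atMost_iff)
      have W: "(\<Prod>j\<le>k. \<Prod>i<j. \<chi> d (((x'(?K := a))(0 := h)) i) (((x'(?K := a))(0 := h)) j) powi \<Gamma> i j) =
          (\<Prod>j\<le>k. \<Prod>i<j. \<chi> d (y i) (y j) powi \<Gamma> i j)"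
        by (intro prod.cong refl) (simp only: y_low atMost_iff lessThan_iff order.trans[OF less_imp_le])
      have "(x j - \<Gamma> ?K j * x ?K) mod int d = b j mod int d \<longleftrightarrow>
          x j = (b j + \<Gamma> ?K j * y ?K) mod int d" if "j \<in> {?K<..n}" for j
      proof -
        have "(x j - \<Gamma> ?K j * x ?K) mod int d = b j mod int d \<longleftrightarrow>
            x j mod int d = (b j + \<Gamma> ?K j * y ?K) mod int d"
          by (simp add: mod_eq_dvd_iff y_def algebra_simps)
        then show ?thesis using Z[of j] that by simp
      qed
      moreover have "{k<..n} = insert ?K {?K<..n}" using k by auto
      ultimately have "(\<forall>j\<in>{k<..n}. (x'(?K := a)) j = b j mod int d) \<longleftrightarrow> a = b ?K mod int d \<and> ?Q"
        by (auto simp: x'_def)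
      then show ?thesis
        unfolding partial_code_def b W using in_C by (simp add: W_def)
    qed
    have "foldr (\<circ>) (shifts d n \<Gamma> ?K ?K) id (fourier_gate d ?Y ?K (?P k)) x =
        fourier_gate d ?Y ?K (?P k) x'"
      using shifts_apply[OF d K x] by (simp add: x'_def)
    also have "\<dots> = of_real (1 / sqrt (real d)) *
        (\<Sum>a\<in>Zmod d. \<chi> d a (x' ?K) * ?P k (x'(?K := a)))"
      using K x' by (intro fourier_gate_apply) auto
    also have "(\<Sum>a\<in>Zmod d. \<chi> d a (x' ?K) * ?P k (x'(?K := a))) =
        (\<Sum>a\<in>Zmod d. if a = b ?K mod int d then \<chi> d a (y ?K) * (if ?Q then W else 0) else 0)"
      by (intro sum.cong refl) (simp add: step, simp add: x'_def y_def)
    also have "\<dots> = \<chi> d (b ?K) (y ?K) * (if ?Q then W else 0)"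
      using mod_in_Zmod[OF d] by (simp add: Zmod_def \<chi>_mod[OF d])
    \<comment> \<open>The stored value has become the phase of all edges from \<open>Suc k\<close>
      to smaller vertices, the new factor in the product for stage \<open>Suc k\<close>.\<close>
    also have "\<chi> d (b ?K) (y ?K) = (\<Prod>i<?K. \<chi> d (y i) (y ?K) powi \<Gamma> i ?K)"
      by (simp add: b_def \<chi>_sum lessThan_Suc_atMost)
    also have "of_real (1 / sqrt (real d)) *
        ((\<Prod>i<?K. \<chi> d (y i) (y ?K) powi \<Gamma> i ?K) * (if ?Q then W else 0)) = ?P ?K x"
    proof -
      have "(\<Sum>i\<le>?K. \<Gamma> i j * y i) = b j + \<Gamma> ?K j * y ?K" for j
        by (simp add: b_def)
      then show ?thesis
        unfolding partial_code_def y_def[symmetric] prod.atMost_Suc using x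
        by (simp add: W_def mult_ac del: prod.lessThan_Suc)
    qed
    finally show "foldr (\<circ>) (shifts d n \<Gamma> ?K ?K) id (fourier_gate d ?Y ?K (?P k)) x = ?P ?K x" .
  qed (rule partial_code_l2)
  then show ?thesis
    unfolding foldr_comp_append by simp
qed

section \<open>The full circuit and its gate count\<close>

fun encoder :: "nat \<Rightarrow> nat \<Rightarrow> (nat \<Rightarrow> nat \<Rightarrow> int) \<Rightarrow> nat \<Rightarrow> (state \<Rightarrow> state) list" where
  "encoder d n \<Gamma> 0 = shifts d n \<Gamma> 0 1"
| "encoder d n \<Gamma> (Suc k) =
     (shifts d n \<Gamma> (Suc k) (Suc k) @ [fourier_gate d {1..n} (Suc k)]) @ encoder d n \<Gamma> k"

lemma encoder_elementary:
  "n > 0 \<Longrightarrow> k \<le> n \<Longrightarrow> set (encoder d n \<Gamma> k) \<subseteq> elementary_gates d {1..n}"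
proof (induction k)
  case 0
  then show ?case using shifts_elementary[of 1 n] by simp
next
  case (Suc k)
  then have k: "Suc k \<in> {1..n}" by simp
  then have "fourier_gate d {1..n} (Suc k) \<in> elementary_gates d {1..n}"
    unfolding elementary_gates_def by blast
  then show ?case
    using shifts_elementary[OF k, of d \<Gamma> "Suc k"] Suc by simp
qed

lemma encoder_apply:
  assumes "d > 0" "n > 0" "h \<in> Zmod d" "\<Gamma> 0 1 = 1" "k \<le> n"
  shows "foldr (\<circ>) (encoder d n \<Gamma> k) id (ket (\<lambda>i\<in>{1..n}. if i = 1 then h else 0)) =
    partial_code d n \<Gamma> h k"
  using assms(5)
proof (induction k)
  case 0
  show ?case unfolding encoder.simps using assms(1-4) by (rule partial_code_0)
next
  case (Suc k)
  show ?case
    unfolding encoder.simps foldr_comp_append[of _ "encoder d n \<Gamma> k"]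
      comp_apply[of _ "foldr (\<circ>) (encoder d n \<Gamma> k) id"]
      Suc.IH[OF Suc_leD[OF Suc.prems]]
    using assms(1) Suc.prems by (rule partial_code_Suc)
qed

text \<open>There are \<open>k\<close> Fourier transforms, and each edge is counted at its smaller
  endpoint. The \<open>+ 1\<close> accounts for the edge {0,1}, which has no gate.\<close>

lemma length_encoder:
  assumes "n > 0" "\<Gamma> 0 1 = 1"
  shows "length (encoder d n \<Gamma> k) + 1 = k + (\<Sum>i\<le>k. card {j \<in> {i<..n}. \<Gamma> i j \<noteq> 0})"
proof (induction k)
  case 0
  \<comment> \<open>Stage 0 shifts only digits above 1, so its count misses exactly vertex
    1.\<close>
  have "{j \<in> {0<..n}. \<Gamma> 0 j \<noteq> 0} = insert 1 {j \<in> {1<..n}. \<Gamma> 0 j \<noteq> 0}"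
    using assms by (auto simp: Suc_lessI)
  then show ?case by (simp add: shifts_def length_targets)
next
  case (Suc k)
  then show ?case by (simp add: shifts_def length_targets)
qed

text \<open>Listing the smaller endpoint first makes edges correspond bijectively to ordered
  pairs.\<close>

lemma card_edges:
  assumes "weighted_graph {0..n} \<Gamma>"
  shows "card (edges {0..n} \<Gamma>) = (\<Sum>i\<le>n. card {j \<in> {i<..n}. \<Gamma> i j \<noteq> 0})"
proof -
  let ?S = "SIGMA i:{..n}. {j \<in> {i<..n}. \<Gamma> i j \<noteq> 0}"
  have "edges {0..n} \<Gamma> = (\<lambda>(i, j). {i, j}) ` ?S"
  proof (intro equalityI subsetI)
    fix e assume "e \<in> edges {0..n} \<Gamma>"
    then obtain i j where e: "e = {i, j}" "i \<le> n" "j \<le> n" "i \<noteq> j" "\<Gamma> i j \<noteq> 0"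
      by (auto simp: edges_def)
    \<comment> \<open>Symmetry of the weights allows the edge to be oriented upwards.\<close>
    moreover have "\<Gamma> j i \<noteq> 0" using assms e by (auto simp: weighted_graph_def)
    ultimately have "(i, j) \<in> ?S \<or> (j, i) \<in> ?S" by auto
    then show "e \<in> (\<lambda>(i, j). {i, j}) ` ?S"
      by (elim disjE) (erule rev_image_eqI, simp add: e(1) insert_commute)+
  next
    fix e assume "e \<in> (\<lambda>(i, j). {i, j}) ` ?S"
    then show "e \<in> edges {0..n} \<Gamma>" by (force simp: edges_def)
  qed
  moreover have "inj_on (\<lambda>(i, j). {i, j}) ?S"
    by (auto simp: inj_on_def doubleton_eq_iff)
  ultimately show ?thesis by (simp add: card_image)
qed

section \<open>Identification of the last stage with the graph code\<close>

lemma graph_code_ket: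
  assumes "d > 0" "h \<in> configs d {0}"
  shows "graph_code d {0} {1..n} \<Gamma> (ket h) = partial_code d n \<Gamma> (h 0) n"
proof (rule l2_eqI)
  let ?w = "\<lambda>x. cluster_wave d ({0} \<union> {1..n}) \<Gamma> (join {0} h x)"
  have fin: "finite (configs d {1..n})" by (simp add: finite_configs)
  have eq: "graph_code d {0} {1..n} \<Gamma> (ket h) x =
      of_real (real d powr (1 / 2)) * (\<Sum>g\<in>configs d {1..n}. ?w g * ket g x)" for x
    unfolding graph_code_def using assms(2) by (subst lin_ext_ket) auto
  then show "graph_code d {0} {1..n} \<Gamma> (ket h) \<in> l2 d {1..n}"
    by (auto simp: l2_def ket_def intro!: sum.neutral)
  fix x assume x: "x \<in> configs d {1..n}"
  let ?y = "x(0 := h 0)"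
  have join: "join {0} h x = ?y" by (auto simp: join_def)
  have "(\<Sum>g\<in>configs d {1..n}. ?w g * ket g x) = (\<Sum>g\<in>configs d {1..n}. if g = x then ?w g else 0)"
    by (intro sum.cong) (auto simp: ket_def)
  also have "\<dots> = ?w x" using x fin by simp
  finally have sum: "(\<Sum>g\<in>configs d {1..n}. ?w g * ket g x) = ?w x" .
  have V: "{0} \<union> {1..n} = {0..n}" by auto
  \<comment> \<open>Vertex pairs are regrouped by their larger endpoint, matching the product in
    \<open>partial_code\<close>.\<close>
  have "{(i, j). i \<in> {0..n} \<and> j \<in> {0..n} \<and> i < j} = prod.swap ` (SIGMA j:{..n}. {..<j})"
    by (auto simp: image_iff)
  then have prod: "(\<Prod>(i, j)\<in>{(i, j). i \<in> {0..n} \<and> j \<in> {0..n} \<and> i < j}. \<chi> d (?y i) (?y j) powi \<Gamma> i j) =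
      (\<Prod>j\<le>n. \<Prod>i<j. \<chi> d (?y i) (?y j) powi \<Gamma> i j)"
    by (simp add: prod.reindex prod.Sigma case_prod_unfold del: fun_upd_apply)
  \<comment> \<open>There are \<open>n + 1\<close> vertices and one input, so the powers of
    \<open>d\<close> combine to the exponent -n/2, one factor for each of the \<open>n\<close>
    Fourier transforms.\<close>
  have "real d powr (1 / 2) * real d powr (- (real (Suc n) / 2)) = real d powr (- (real n / 2))"
    by (simp add: powr_add[symmetric] field_simps)
  also have "\<dots> = (real d powr (- (1 / 2))) powr real n"
    by (simp add: powr_powr)
  also have "\<dots> = (1 / sqrt (real d)) ^ n"
    using assms(1) by (simp add: powr_realpow powr_minus_divide powr_half_sqrt)
  finally have c: "of_real (real d powr (1 / 2)) * of_real (real d powr (- (real (Suc n) / 2))) =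
      (of_real ((1 / sqrt (real d)) ^ n) :: complex)"
    by (metis of_real_mult)
  have "graph_code d {0} {1..n} \<Gamma> (ket h) x = of_real (real d powr (1 / 2)) *
      (of_real (real d powr (- (real (Suc n) / 2))) *
      (\<Prod>j\<le>n. \<Prod>i<j. \<chi> d (?y i) (?y j) powi \<Gamma> i j))"
    unfolding eq sum join unfolding cluster_wave_def V prod by simp
  \<comment> \<open>No digit lies above \<open>n\<close>, so the storage condition is vacuous at the
    last stage.\<close>
  also have "\<dots> = partial_code d n \<Gamma> (h 0) n x"
    unfolding mult.assoc[symmetric] c partial_code_def using x by simp
  finally show "graph_code d {0} {1..n} \<Gamma> (ket h) x = partial_code d n \<Gamma> (h 0) n x" .
qed (rule partial_code_l2)

theorem propositionV1:
  fixes d n l :: nat and \<Gamma> :: "nat \<Rightarrow> nat \<Rightarrow> int"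
  assumes "d > 0" and "n > 0"
    and "weighted_graph {0..n} \<Gamma>"
    and "card (edges {0..n} \<Gamma>) = l"
    and "\<Gamma> 0 1 = 1"
  shows "\<exists>z. unitary_l2 d {1..n} z \<and>
           (\<forall>\<psi>\<in>l2 d {0}. graph_code d {0} {1..n} \<Gamma> \<psi> = z (embed_first d n \<psi>)) \<and>
           (\<exists>gs. length gs = l + n - 1 \<and> set gs \<subseteq> elementary_gates d {1..n} \<and>
              (\<forall>\<psi>\<in>l2 d {1..n}. z \<psi> = foldr (\<circ>) gs id \<psi>))"
proof -
  define gs where "gs = encoder d n \<Gamma> n"
  define z where "z = foldr (\<circ>) gs id"
  let ?B = "\<lambda>h. \<lambda>i\<in>{1..n}. if i = 1 then h 0 else 0"
  have gs: "set gs \<subseteq> elementary_gates d {1..n}"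
    unfolding gs_def using assms(2) by (intro encoder_elementary) auto
  have len: "length gs = l + n - 1"
    using length_encoder[of n \<Gamma> d n] card_edges[OF assms(3)] assms by (simp add: gs_def)
  have z: "unitary_l2 d {1..n} z"
    unfolding z_def using gs assms(1) by (intro unitary_l2_foldr unitary_elementary_gate) auto
  have ket: "graph_code d {0} {1..n} \<Gamma> (ket h) = z (ket (?B h))" if "h \<in> configs d {0}" for h
    unfolding z_def gs_def graph_code_ket[OF assms(1) that]
    using encoder_apply[of d n "h 0" \<Gamma> n] assms configs_in_Zmod[OF that] by simp
  \<comment> \<open>The identity on basis states extends by linearity of \<open>z\<close>, because
    \<open>graph_code\<close> and \<open>embed_first\<close> are both linear extensions from the
    basis.\<close>
  have "graph_code d {0} {1..n} \<Gamma> \<psi> = z (embed_first d n \<psi>)" for \<psi>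
  proof -
    have B: "?B h \<in> configs d {1..n}" if "h \<in> configs d {0}" for h
      using configs_in_Zmod[OF that, of 0] assms(1) by (auto simp: configs_def Zmod_def)
    have lin: "linear_l2 d {1..n} {1..n} z" using z by (simp add: unitary_l2_def)
    have "z (embed_first d n \<psi>) = (\<lambda>x. \<Sum>h\<in>configs d {0}. \<psi> h * z (ket (?B h)) x)"
      unfolding embed_first_def lin_ext_def
      by (rule linear_l2_sum[OF lin]) (intro ket_in_l2 B)
    also have "\<dots> = (\<lambda>x. \<Sum>h\<in>configs d {0}. \<psi> h * graph_code d {0} {1..n} \<Gamma> (ket h) x)"
      by (intro ext sum.cong refl) (simp only: ket)
    also have "\<dots> = graph_code d {0} {1..n} \<Gamma> \<psi>"
      unfolding graph_code_def lin_ext_def[of d "{0}" _ \<psi>]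
      by (intro ext sum.cong refl) (subst lin_ext_ket; simp)
    finally show ?thesis by (rule sym)
  qed
  then show ?thesis
    using z gs len by (intro exI[of _ z] conjI exI[of _ gs] ballI) (simp_all only: z_def)
qed

end
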